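(* Let $\mathcal{R}$ be a rule set (a finite set of existential rules), let $\mathcal{D}$ be a database, and let $\exists \vec{x}\, q(\vec{x})$ be a Boolean conjunctive query. Then there exists a chase derivation $(\mathcal{I}_i,\tau_i)_{i\in[n]}$ (for some $n\in\mathbb{N}$, $n \geq 0$) witnessing $(\mathcal{D},\mathcal{R})\models \exists \vec{x}\, q(\vec{x})$ if and only if there exists a proof in the sequent calculus $\mathsf{G3}(\mathcal{R})$ of the sequent $\mathcal{D}\vdash \exists \vec{x}\, q(\vec{x})$.
   Context: **Syntax.** $\mathbf{C}$ and $\mathbf{V}$ are disjoint denumerable sets of constants and variables; $\mathbf{T}=\mathbf{C}\cup\mathbf{V}$ is the set of terms. $\mathbf{P}$ is a denumerable set of predicates with denumerably many of each arity $n\in\mathbb{N}$. An atom is $p(t_1,\dots,t_n)$ with $p \in \mathbf{P}$ of arity $n$ and $t_i\in\mathbf{T}$; it is ground if all $t_i\in\mathbf{C}$. Formulae: $\phi ::= p(\vec t)\mid \neg\phi\mid\phi\wedge\phi\mid\exists x\phi$; $\vee,\to,\forall$ are the usual abbreviations. $\phi(t/x)$ is the (capture-avoiding) substitution of $t$ for the free occurrences of $x$. An instance is a (possibly infinite) set of atoms; a database is a finite set of ground atoms. $\mathbf{T}(\mathcal{I})$ is the set of terms occurring in $\mathcal{I}$. $[n]=\{1,\dots,n\}$. **Existential rules and queries.** An existential rule is a sentence $\rho=\forall\vec x\vec y\,\beta(\vec x,\vec y)\to\exists\vec z\,\alpha(\vec y,\vec z)$, where the body $\beta$ and the head $\alpha$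 are (nonempty, finite) conjunctions of atoms over constants and the variables $\vec x,\vec y$, respectively $\vec y,\vec z$; all of $\vec x,\vec y$ occur in $\beta$. Conjunctions of atoms are identified with sets of atoms when convenient. A Boolean conjunctive query (BCQ) is $\exists\vec x\,q(\vec x)$ with $q$ a (nonempty, finite) conjunction of atoms over constants and the variables $\vec x$, all of which occur in $q$. **Chase derivations.** An $\mathcal{I}$-assignment is a substitution $\mu$ mapping variables to elements of $\mathbf{T}(\mathcal{I})$ and every constant to itself (only its values on the variables of the formula it is applied to matter). A trigger in $\mathcal{I}$ is a pair $\tau=(\rho,\mu)$ with $\mu$ an $\mathcal{I}$-assignment such that $\mu(\beta(\vec x,\vec y))\subseteq\mathcal{I}$. Its application is $\tau(\mathcal{I})=\mathcal{I}\cup\alpha(\mu(\vec y),\vec z)$, where $\vec z$ is taken to be a tuple of pairwise distinct fresh variables (not occurring in $\mathcal{I}$). A chase derivation $(\mathcal{I}_i,\tau_i)_{i\in[n]}$ is a sequence $(\mathcal{I}_1,\tau_1),\dots,(\mathcal{I}_n,\tau_n),(\mathcal{I}_{n+1},\emptyset)$ such that for each $i\in[n]$, $\tau_i$ is a trigger in $\mathcal{I}_i$ and $\tau_i(\mathcal{I}_i)=\mathcal{I}_{i+1}$. It witnesses $(\mathcal{D},\mathcal{R})\models\exists\vec x\,q(\vec x)$ iff $\mathcal{I}_1=\mathcal{D}$, only rules from $\mathcal{R}$ are applied, and there is an $\mathcal{I}_{n+1}$-assignment $\mu$ with $\mu(q(\vec x))\subseteq\mathcal{I}_{n+1}$. **Sequent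 calculus.** A sequent $\Gamma\vdash\Delta$ is a pair of finite sets of formulae; commas denote union. $\mathsf{G3}$ has the rules (premise(s) / conclusion): - $(id)$: no premise / $\Gamma,p(\vec t)\vdash p(\vec t),\Delta$, with $p(\vec t)$ an atom; - $(\neg_L)$: $\Gamma\vdash\phi,\Delta$ / $\Gamma,\neg\phi\vdash\Delta$; - $(\neg_R)$: $\Gamma,\phi\vdash\Delta$ / $\Gamma\vdash\neg\phi,\Delta$; - $(\wedge_L)$: $\Gamma,\phi,\psi\vdash\Delta$ / $\Gamma,\phi\wedge\psi\vdash\Delta$; - $(\wedge_R)$: $\Gamma\vdash\phi,\Delta$ and $\Gamma\vdash\psi,\Delta$ / $\Gamma\vdash\phi\wedge\psi,\Delta$; - $(\exists_L)$: $\Gamma,\phi(y/x)\vdash\Delta$ / $\Gamma,\exists x\phi\vdash\Delta$, with $y$ a variable not occurring in the conclusion; - $(\exists_R)$: $\Gamma\vdash\exists x\phi,\phi(t/x),\Delta$ / $\Gamma\vdash\exists x\phi,\Delta$, with $t\in\mathbf{T}$ arbitrary. For an existential rule $\rho=\forall\vec x\vec y\,\beta(\vec x,\vec y)\to\exists\vec z\,\alpha(\vec y,\vec z)$, the sequent rule $s(\rho)$ is: $\Gamma,\beta(\vec x,\vec y),\alpha(\vec y,\vec z)\vdash\Delta$ / $\Gamma,\beta(\vec x,\vec y)\vdash\Delta$, where $\beta,\alpha$ are read as sets of atoms, $\vec x,\vec y$ may be instantiated by arbitrary terms, and $\vec z$ is instantiated by pairwise distinct fresh variables (not occurring in the conclusion).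 $\mathsf{G3}(\mathcal{R})=\mathsf{G3}\cup\{s(\rho)\mid\rho\in\mathcal{R}\}$. A proof of a sequent is a finite tree of rule applications with that sequent at the root and whose leaves are all instances of $(id)$. *)

theory Defs
  imports Main
begin

section \<open>Syntax\<close>

datatype trm = Const nat | Var nat

text \<open>
  A predicate is a name together with an arity, and the arity is read off the argument list:
  the predicate of \<open>Atom p ts\<close> is the pair \<open>(p, length ts)\<close>. Hence there are denumerably many
  predicates of each arity, and every atom respects the arity of its predicate.
\<close>

datatype atom = Atom nat (args: "trm list")

datatype fm = Atm atom | Neg fm | Conj fm fm | Ex nat fm

fun vars_trm :: "trm \<Rightarrow> nat set" where
  "vars_trm (Const c) = {}"
| "vars_trm (Var x) = {x}"

definition vars_atom :: "atom \<Rightarrow> nat set" where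
  "vars_atom a = (\<Union>t\<in>set (args a). vars_trm t)"

primrec free_vars :: "fm \<Rightarrow> nat set" where
  "free_vars (Atm a) = vars_atom a"
| "free_vars (Neg \<phi>) = free_vars \<phi>"
| "free_vars (Conj \<phi> \<psi>) = free_vars \<phi> \<union> free_vars \<psi>"
| "free_vars (Ex x \<phi>) = free_vars \<phi> - {x}"

text \<open>All variables occurring in a formula: free, bound, or in a quantifier.\<close>

primrec vars_fm :: "fm \<Rightarrow> nat set" where
  "vars_fm (Atm a) = vars_atom a"
| "vars_fm (Neg \<phi>) = vars_fm \<phi>"
| "vars_fm (Conj \<phi> \<psi>) = vars_fm \<phi> \<union> vars_fm \<psi>"
| "vars_fm (Ex x \<phi>) = insert x (vars_fm \<phi>)"

section \<open>Substitution\<close>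

primrec subst_trm :: "(nat \<Rightarrow> trm) \<Rightarrow> trm \<Rightarrow> trm" where
  "subst_trm \<sigma> (Const c) = Const c"
| "subst_trm \<sigma> (Var x) = \<sigma> x"

primrec subst_atom :: "(nat \<Rightarrow> trm) \<Rightarrow> atom \<Rightarrow> atom" where
  "subst_atom \<sigma> (Atom p ts) = Atom p (map (subst_trm \<sigma>) ts)"

text \<open>
  Capture-avoiding simultaneous substitution. In the quantifier case \<open>V\<close> is the set of variables
  brought in for the free variables of \<open>Ex x \<phi>\<close>; the bound variable is renamed, to the
  first variable outside \<open>V\<close>, exactly when it would capture one of them.
\<close>

primrec subst_fm :: "(nat \<Rightarrow> trm) \<Rightarrow> fm \<Rightarrow> fm" where
  "subst_fm \<sigma> (Atm a) = Atm (subst_atom \<sigma> a)"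
| "subst_fm \<sigma> (Neg \<phi>) = Neg (subst_fm \<sigma> \<phi>)"
| "subst_fm \<sigma> (Conj \<phi> \<psi>) = Conj (subst_fm \<sigma> \<phi>) (subst_fm \<sigma> \<psi>)"
| "subst_fm \<sigma> (Ex x \<phi>) =
     (let V = (\<Union>v\<in>free_vars \<phi> - {x}. vars_trm (\<sigma> v));
          x' = (if x \<in> V then LEAST z. z \<notin> V else x)
      in Ex x' (subst_fm (\<sigma>(x := Var x')) \<phi>))"

text \<open>\<open>subst1 \<phi> t x\<close> is \<open>\<phi>(t/x)\<close>.\<close>

definition subst1 :: "fm \<Rightarrow> trm \<Rightarrow> nat \<Rightarrow> fm" where
  "subst1 \<phi> t x = subst_fm (Var(x := t)) \<phi>"

section \<open>Instances, rules and queries\<close>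

type_synonym inst = "atom set"

definition terms :: "inst \<Rightarrow> trm set" where
  "terms I = (\<Union>a\<in>I. set (args a))"

definition vars_inst :: "inst \<Rightarrow> nat set" where
  "vars_inst I = (\<Union>a\<in>I. vars_atom a)"

definition ground :: "atom \<Rightarrow> bool" where
  "ground a \<longleftrightarrow> (\<forall>t\<in>set (args a). \<exists>c. t = Const c)"

definition database :: "inst \<Rightarrow> bool" where
  "database D \<longleftrightarrow> finite D \<and> (\<forall>a\<in>D. ground a)"

text \<open>Conjunctions of atoms (arbitrarily bracketed), and the set of atoms of such a conjunction.\<close>

fun atom_conj :: "fm \<Rightarrow> bool" where
  "atom_conj (Atm a) = True"
| "atom_conj (Conj \<phi> \<psi>) = (atom_conj \<phi> \<and> atom_conj \<psi>)"
| "atom_conj _ = False"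

primrec atoms :: "fm \<Rightarrow> atom set" where
  "atoms (Atm a) = {a}"
| "atoms (Neg \<phi>) = atoms \<phi>"
| "atoms (Conj \<phi> \<psi>) = atoms \<phi> \<union> atoms \<psi>"
| "atoms (Ex x \<phi>) = atoms \<phi>"

text \<open>
  \<open>ERule xs ys zs \<beta> \<alpha>\<close> stands for the sentence
  \<open>\<forall>xs ys. \<beta>(xs, ys) \<longrightarrow> (\<exists>zs. \<alpha>(ys, zs))\<close>.
\<close>

datatype erule =
  ERule (xvars: "nat list") (yvars: "nat list") (zvars: "nat list") (body: fm) (head: fm)

definition existential_rule :: "erule \<Rightarrow> bool" where
  "existential_rule \<rho> \<longleftrightarrow>
     distinct (xvars \<rho> @ yvars \<rho> @ zvars \<rho>) \<and>
     atom_conj (body \<rho>) \<and> atom_conj (head \<rho>) \<and>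
     vars_fm (body \<rho>) = set (xvars \<rho>) \<union> set (yvars \<rho>) \<and>
     vars_fm (head \<rho>) \<subseteq> set (yvars \<rho>) \<union> set (zvars \<rho>)"

definition rule_set :: "erule set \<Rightarrow> bool" where
  "rule_set R \<longleftrightarrow> finite R \<and> (\<forall>\<rho>\<in>R. existential_rule \<rho>)"

definition exists_vars :: "nat list \<Rightarrow> fm \<Rightarrow> fm" where
  "exists_vars xs \<phi> = foldr Ex xs \<phi>"

text \<open>\<open>bcq xs q\<close>: the formula \<open>exists_vars xs q\<close> is a Boolean conjunctive query.\<close>

definition bcq :: "nat list \<Rightarrow> fm \<Rightarrow> bool" where
  "bcq xs q \<longleftrightarrow> distinct xs \<and> atom_conj q \<and> vars_fm q = set xs"

section \<open>Chase derivations\<close>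

text \<open>
  Only the values of an assignment on the variables \<open>X\<close> of the formula it is applied to matter.
  Restricting the condition to \<open>X\<close> keeps assignments available when \<open>terms I\<close> is empty,
  that is, when all atoms of \<open>I\<close> are nullary.
\<close>

definition assignment :: "inst \<Rightarrow> nat set \<Rightarrow> (nat \<Rightarrow> trm) \<Rightarrow> bool" where
  "assignment I X \<mu> \<longleftrightarrow> (\<forall>x\<in>X. \<mu> x \<in> terms I)"

type_synonym trigger = "erule \<times> (nat \<Rightarrow> trm)"

definition is_trigger :: "inst \<Rightarrow> trigger \<Rightarrow> bool" where
  "is_trigger I \<tau> \<longleftrightarrow> (case \<tau> of (\<rho>, \<mu>) \<Rightarrow>
     assignment I (vars_fm (body \<rho>)) \<mu> \<and> subst_atom \<mu> ` atoms (body \<rho>) \<subseteq> I)"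

text \<open>\<open>with_fresh \<mu> zs \<zeta>\<close> instantiates \<open>zs\<close> by the variables \<open>\<zeta> z\<close> and all else by \<open>\<mu>\<close>.\<close>

definition with_fresh :: "(nat \<Rightarrow> trm) \<Rightarrow> nat list \<Rightarrow> (nat \<Rightarrow> nat) \<Rightarrow> nat \<Rightarrow> trm" where
  "with_fresh \<mu> zs \<zeta> v = (if v \<in> set zs then Var (\<zeta> v) else \<mu> v)"

text \<open>
  The result of a trigger application depends on the choice of fresh variables, so
  \<open>\<tau>(I) = I'\<close> is rendered as a relation: \<open>I'\<close> is a result for some choice of them.
\<close>

definition application :: "trigger \<Rightarrow> inst \<Rightarrow> inst \<Rightarrow> bool" where
  "application \<tau> I I' \<longleftrightarrow> (case \<tau> of (\<rho>, \<mu>) \<Rightarrow>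
     \<exists>\<zeta>. inj_on \<zeta> (set (zvars \<rho>)) \<and> \<zeta> ` set (zvars \<rho>) \<inter> vars_inst I = {} \<and>
         I' = I \<union> subst_atom (with_fresh \<mu> (zvars \<rho>) \<zeta>) ` atoms (head \<rho>))"

text \<open>
  Sequences indexed by \<open>{1..n}\<close> (resp. \<open>{1..n+1}\<close>) are functions on \<open>nat\<close> whose values at
  other indices are irrelevant. In particular \<open>\<tau> (n + 1)\<close> is ignored, as the last
  instance carries no trigger.
\<close>

definition chase_derivation :: "nat \<Rightarrow> (nat \<Rightarrow> inst) \<Rightarrow> (nat \<Rightarrow> trigger) \<Rightarrow> bool" where
  "chase_derivation n I \<tau> \<longleftrightarrow>
     (\<forall>i\<in>{1..n}. is_trigger (I i) (\<tau> i) \<and> application (\<tau> i) (I i) (I (i + 1)))"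

definition witnesses ::
  "nat \<Rightarrow> (nat \<Rightarrow> inst) \<Rightarrow> (nat \<Rightarrow> trigger) \<Rightarrow> inst \<Rightarrow> erule set \<Rightarrow> fm \<Rightarrow> bool" where
  "witnesses n I \<tau> D R q \<longleftrightarrow>
     I 1 = D \<and> (\<forall>i\<in>{1..n}. fst (\<tau> i) \<in> R) \<and>
     (\<exists>\<mu>. assignment (I (n + 1)) (vars_fm q) \<mu> \<and> subst_atom \<mu> ` atoms q \<subseteq> I (n + 1))"

section \<open>The sequent calculus\<close>

definition vars_seq :: "fm set \<Rightarrow> fm set \<Rightarrow> nat set" where
  "vars_seq \<Gamma> \<Delta> = (\<Union>\<phi>\<in>\<Gamma> \<union> \<Delta>. vars_fm \<phi>)"

text \<open>
  \<open>G3 R \<Gamma> \<Delta>\<close>: the sequent with antecedent \<open>\<Gamma>\<close> and succedent \<open>\<Delta>\<close> has a proof in the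
  calculus extended by the rules \<open>s(\<rho>)\<close> for \<open>\<rho> \<in> R\<close>. All sequents in a proof are pairs of finite
  sets: this is required at the leaves, and every other rule has finite premises iff its
  conclusion is finite.
\<close>

inductive G3 :: "erule set \<Rightarrow> fm set \<Rightarrow> fm set \<Rightarrow> bool" for R :: "erule set" where
  Id: "finite \<Gamma> \<Longrightarrow> finite \<Delta> \<Longrightarrow> G3 R (insert (Atm a) \<Gamma>) (insert (Atm a) \<Delta>)"
| NegL: "G3 R \<Gamma> (insert \<phi> \<Delta>) \<Longrightarrow> G3 R (insert (Neg \<phi>) \<Gamma>) \<Delta>"
| NegR: "G3 R (insert \<phi> \<Gamma>) \<Delta> \<Longrightarrow> G3 R \<Gamma> (insert (Neg \<phi>) \<Delta>)"
| ConjL: "G3 R (insert \<phi> (insert \<psi> \<Gamma>)) \<Delta> \<Longrightarrow> G3 R (insert (Conj \<phi> \<psi>) \<Gamma>) \<Delta>"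
| ConjR: "G3 R \<Gamma> (insert \<phi> \<Delta>) \<Longrightarrow> G3 R \<Gamma> (insert \<psi> \<Delta>) \<Longrightarrow> G3 R \<Gamma> (insert (Conj \<phi> \<psi>) \<Delta>)"
| ExL: "G3 R (insert (subst1 \<phi> (Var y) x) \<Gamma>) \<Delta> \<Longrightarrow>
    y \<notin> vars_seq (insert (Ex x \<phi>) \<Gamma>) \<Delta> \<Longrightarrow> G3 R (insert (Ex x \<phi>) \<Gamma>) \<Delta>"
| ExR: "G3 R \<Gamma> (insert (Ex x \<phi>) (insert (subst1 \<phi> t x) \<Delta>)) \<Longrightarrow> G3 R \<Gamma> (insert (Ex x \<phi>) \<Delta>)"
| Rule: "\<rho> \<in> R \<Longrightarrow>
    B = Atm ` subst_atom \<sigma> ` atoms (body \<rho>) \<Longrightarrow>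
    A = Atm ` subst_atom (with_fresh \<sigma> (zvars \<rho>) \<zeta>) ` atoms (head \<rho>) \<Longrightarrow>
    inj_on \<zeta> (set (zvars \<rho>)) \<Longrightarrow>
    \<zeta> ` set (zvars \<rho>) \<inter> vars_seq (\<Gamma> \<union> B) \<Delta> = {} \<Longrightarrow>
    G3 R (\<Gamma> \<union> B \<union> A) \<Delta> \<Longrightarrow> G3 R (\<Gamma> \<union> B) \<Delta>"

end

theory Submission
  imports Defs
begin

text \<open>
  Both directions carry a substitution along. From the chase to a proof, the instances are mapped
  by a substitution whose range avoids the quantified variables of the query, since the fresh
  variables of the chase may clash with these whereas those of the sequent rules may not. From a
  proof to the chase, one shows soundness: if \<open>\<Gamma> \<turnstile> \<Delta>\<close> is provable, \<open>\<Gamma>\<close> consists of atoms and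
  \<open>\<Delta>\<close> is free of negation, then every finite instance satisfying \<open>\<Gamma>\<close> under an environment can be
  chased to one satisfying a formula of \<open>\<Delta>\<close> under the same environment. Quantifying over all
  instances makes the two branches of \<open>ConjR\<close> composable: the second chase is run from the
  result of the first, which preserves negation-free formulae.
\<close>

section \<open>Substitutions\<close>

lemma finite_vars_trm [simp]: "finite (vars_trm t)"
  by (cases t) auto

lemma finite_vars_atom [simp]: "finite (vars_atom a)"
  by (auto simp: vars_atom_def)

lemma finite_vars_fm [simp]: "finite (vars_fm \<phi>)"
  by (induction \<phi>) auto

lemma finite_free_vars [simp]: "finite (free_vars \<phi>)"
  by (induction \<phi>) auto

lemma free_vars_subset_vars_fm: "free_vars \<phi> \<subseteq> vars_fm \<phi>"
  by (induction \<phi>) auto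

lemma finite_atoms [simp]: "finite (atoms \<phi>)"
  by (induction \<phi>) auto

lemma vars_atom_subset_vars_fm: "a \<in> atoms \<phi> \<Longrightarrow> vars_atom a \<subseteq> vars_fm \<phi>"
  by (induction \<phi>) auto

lemma vars_fm_atom_conj: "atom_conj \<phi> \<Longrightarrow> vars_fm \<phi> = vars_inst (atoms \<phi>)"
  by (induction \<phi> rule: atom_conj.induct) (auto simp: vars_inst_def)

lemma finite_vars_inst: "finite I \<Longrightarrow> finite (vars_inst I)"
  by (simp add: vars_inst_def)

lemma subst_trm_cong: "(\<And>v. v \<in> vars_trm t \<Longrightarrow> \<sigma> v = \<sigma>' v) \<Longrightarrow> subst_trm \<sigma> t = subst_trm \<sigma>' t"
  by (cases t) auto

lemma subst_trm_comp: "subst_trm \<sigma> (subst_trm \<sigma>' t) = subst_trm (\<lambda>v. subst_trm \<sigma> (\<sigma>' v)) t"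
  by (cases t) auto

lemma subst_trm_Var [simp]: "subst_trm Var t = t"
  by (cases t) auto

lemma vars_subst_trm: "vars_trm (subst_trm \<sigma> t) = (\<Union>v\<in>vars_trm t. vars_trm (\<sigma> v))"
  by (cases t) auto

lemma subst_atom_cong:
  "(\<And>v. v \<in> vars_atom a \<Longrightarrow> \<sigma> v = \<sigma>' v) \<Longrightarrow> subst_atom \<sigma> a = subst_atom \<sigma>' a"
  by (cases a) (auto simp: vars_atom_def intro!: subst_trm_cong)

lemma subst_atom_comp: "subst_atom \<sigma> (subst_atom \<sigma>' a) = subst_atom (\<lambda>v. subst_trm \<sigma> (\<sigma>' v)) a"
  by (cases a) (auto simp: subst_trm_comp)

lemma subst_atom_Var [simp]: "subst_atom Var a = a"
  by (cases a) (auto simp: map_idI)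

lemma vars_subst_atom: "vars_atom (subst_atom \<sigma> a) = (\<Union>v\<in>vars_atom a. vars_trm (\<sigma> v))"
  by (cases a) (auto simp: vars_atom_def vars_subst_trm)

lemma subst_var_in_args: "v \<in> vars_atom a \<Longrightarrow> \<sigma> v \<in> set (args (subst_atom \<sigma> a))"
proof -
  assume "v \<in> vars_atom a"
  then obtain t where t: "t \<in> set (args a)" "v \<in> vars_trm t"
    by (auto simp: vars_atom_def)
  from t(2) have "t = Var v"
    by (cases t) auto
  with t(1) show ?thesis
    by (cases a) force
qed

lemma vars_in_terms: "t \<in> terms I \<Longrightarrow> vars_trm t \<subseteq> vars_inst I"
  by (auto simp: terms_def vars_inst_def vars_atom_def)

text \<open>Every variable of a conjunction of atoms occurs in one of the atoms, so its value is an
  argument of an atom of \<open>I\<close>. A match is therefore an assignment automatically.\<close>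

lemma assignment_if_match:
  assumes "atom_conj \<phi>" and "subst_atom \<mu> ` atoms \<phi> \<subseteq> I"
  shows "assignment I (vars_fm \<phi>) \<mu>"
  using assms subst_var_in_args
  by (fastforce simp: assignment_def vars_fm_atom_conj vars_inst_def terms_def)

lemma ex_fresh_renaming:
  assumes "finite W" and "finite Z"
  obtains \<zeta> :: "nat \<Rightarrow> nat" where "inj_on \<zeta> Z" and "\<zeta> ` Z \<inter> W = {}"
proof -
  obtain m where m: "\<forall>w\<in>W. w < m"
    using assms(1) finite_nat_set_iff_bounded by blast
  \<comment> \<open>Shifting by a strict upper bound \<open>m\<close> of \<open>W\<close> is
    injective and lands outside \<open>W\<close>.\<close>
  show thesis
    by (rule that[of "\<lambda>z. z + m"]) (use m in \<open>auto simp: inj_on_def\<close>)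
qed

section \<open>Chase steps\<close>

text \<open>Hiding trigger and index turns derivations into the reflexive transitive closure of a
  relation, which supports rule induction at either end and concatenation.\<close>

definition step :: "erule set \<Rightarrow> inst \<Rightarrow> inst \<Rightarrow> bool" where
  "step R I I' \<longleftrightarrow> (\<exists>\<tau>. fst \<tau> \<in> R \<and> is_trigger I \<tau> \<and> application \<tau> I I')"

lemma step_finite: "step R I I' \<Longrightarrow> finite I \<Longrightarrow> finite I'"
  by (auto simp: step_def application_def)

lemma steps_finite: "(step R)\<^sup>*\<^sup>* I I' \<Longrightarrow> finite I \<Longrightarrow> finite I'"
  by (induction rule: rtranclp_induct) (auto intro: step_finite)

lemma steps_mono: "(step R)\<^sup>*\<^sup>* I I' \<Longrightarrow> I \<subseteq> I'"
  by (induction rule: rtranclp_induct) (auto simp: step_def application_def)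

lemma steps_if_chase_derivation:
  assumes "chase_derivation n I \<tau>" and "\<forall>i\<in>{1..n}. fst (\<tau> i) \<in> R"
  shows "(step R)\<^sup>*\<^sup>* (I 1) (I (n + 1))"
proof -
  have "k \<le> n \<Longrightarrow> (step R)\<^sup>*\<^sup>* (I 1) (I (k + 1))" for k
  proof (induction k)
    case (Suc k)
    then have "step R (I (k + 1)) (I (k + 1 + 1))"
      using assms unfolding step_def chase_derivation_def
      by (intro exI[of _ "\<tau> (k + 1)"]) auto
    with Suc show ?case
      by (auto intro: rtranclp.rtrancl_into_rtrancl)
  qed simp
  then show ?thesis
    by simp
qed

lemma chase_derivation_if_steps:
  assumes "(step R)\<^sup>*\<^sup>* D J"
  shows "\<exists>n I \<tau>. chase_derivation n I \<tau> \<and> I 1 = D \<and> I (n + 1) = J \<and> (\<forall>i\<in>{1..n}. fst (\<tau> i) \<in> R)"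
  using assms
proof (induction rule: rtranclp_induct)
  case base
  show ?case
    by (rule exI[of _ 0]) (auto simp: chase_derivation_def)
next
  case (step J K)
  then obtain n I \<tau> where n: "chase_derivation n I \<tau>" "I 1 = D" "I (n + 1) = J"
      "\<forall>i\<in>{1..n}. fst (\<tau> i) \<in> R"
    by blast
  from step(2) obtain \<tau>' where \<tau>': "fst \<tau>' \<in> R" "is_trigger J \<tau>'" "application \<tau>' J K"
    by (auto simp: step_def)
  show ?case
    \<comment> \<open>The old derivation ends with \<open>J\<close> at index \<open>n + 1\<close>,
      where \<open>\<tau>\<close> was ignored so far; that slot receives \<open>\<tau>'\<close>, and
      \<open>K\<close> goes to \<open>n + 2\<close>.\<close>
    by (rule exI[of _ "n + 1"], rule exI[of _ "I(n + 2 := K)"], rule exI[of _ "\<tau>(n + 1 := \<tau>')"])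
      (use n \<tau>' in \<open>auto simp: chase_derivation_def\<close>)
qed

lemma ex_witness_iff:
  "(\<exists>n I \<tau>. chase_derivation n I \<tau> \<and> witnesses n I \<tau> D R q) \<longleftrightarrow>
   (\<exists>J \<mu>. (step R)\<^sup>*\<^sup>* D J \<and> assignment J (vars_fm q) \<mu> \<and> subst_atom \<mu> ` atoms q \<subseteq> J)"
  (is "?L \<longleftrightarrow> ?R")
proof
  assume ?L
  then show ?R
    unfolding witnesses_def using steps_if_chase_derivation by metis
next
  assume ?R
  then show ?L
    unfolding witnesses_def using chase_derivation_if_steps by metis
qed

text \<open>Head variables that are not existential lie in \<open>yvars\<close>, and all of these
  occur in the body; hence matching the body fixes their values.\<close>

lemma head_var_cases:
  assumes "existential_rule \<rho>" and "a \<in> atoms (head \<rho>)" and "v \<in> vars_atom a"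
  shows "v \<in> set (zvars \<rho>) \<or> v \<in> vars_inst (atoms (body \<rho>))"
  using assms vars_atom_subset_vars_fm[OF assms(2)] vars_fm_atom_conj[of "body \<rho>"]
  by (auto simp: existential_rule_def)

text \<open>
  Both directions extend a substitution \<open>h\<close> by sending the fresh variables \<open>\<zeta> z\<close> of one rule
  application to the fresh variables \<open>\<zeta>' z\<close> of another one.
\<close>

lemma ex_extend_subst:
  fixes \<zeta> \<zeta>' :: "nat \<Rightarrow> nat"
  assumes "existential_rule \<rho>" and "inj_on \<zeta> (set (zvars \<rho>))" and "\<zeta> ` set (zvars \<rho>) \<inter> W = {}"
    and "vars_inst (subst_atom \<mu> ` atoms (body \<rho>)) \<subseteq> W"
  obtains h' where "\<And>v. v \<in> W \<Longrightarrow> h' v = h v"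
    and "\<And>a. a \<in> atoms (head \<rho>) \<Longrightarrow> subst_atom h' (subst_atom (with_fresh \<mu> (zvars \<rho>) \<zeta>) a) =
           subst_atom (with_fresh (\<lambda>v. subst_trm h (\<mu> v)) (zvars \<rho>) \<zeta>') a"
proof -
  let ?Z = "set (zvars \<rho>)"
  \<comment> \<open>Injectivity of \<open>\<zeta>\<close> lets \<open>inv_into\<close> recover
    \<open>z\<close> from \<open>\<zeta> z\<close>; on \<open>W\<close>, which avoids the range of
    \<open>\<zeta>\<close>, the old \<open>h\<close> survives.\<close>
  define h' where "h' v = (if v \<in> \<zeta> ` ?Z then Var (\<zeta>' (inv_into ?Z \<zeta> v)) else h v)" for v
  have eq: "h' v = h v" if "v \<in> W" for v
    using assms(3) that by (auto simp: h'_def)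
  moreover have "subst_atom h' (subst_atom (with_fresh \<mu> (zvars \<rho>) \<zeta>) a) =
      subst_atom (with_fresh (\<lambda>v. subst_trm h (\<mu> v)) (zvars \<rho>) \<zeta>') a"
    if "a \<in> atoms (head \<rho>)" for a
    unfolding subst_atom_comp
  proof (rule subst_atom_cong)
    fix v
    assume v: "v \<in> vars_atom a"
    show "subst_trm h' (with_fresh \<mu> (zvars \<rho>) \<zeta> v) =
        with_fresh (\<lambda>v. subst_trm h (\<mu> v)) (zvars \<rho>) \<zeta>' v"
    proof (cases "v \<in> ?Z")
      case True
      then show ?thesis
        using assms(2) by (simp add: with_fresh_def h'_def)
    next
      case False
      then have "v \<in> vars_inst (atoms (body \<rho>))"
        using head_var_cases[OF assms(1) that v] by blast
      then have "vars_trm (\<mu> v) \<subseteq> W"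
        using assms(4) by (fastforce simp: vars_inst_def vars_subst_atom)
      then have "subst_trm h' (\<mu> v) = subst_trm h (\<mu> v)"
        using eq by (auto intro!: subst_trm_cong)
      with False show ?thesis
        by (simp add: with_fresh_def)
    qed
  qed
  ultimately show thesis
    using that by blast
qed

section \<open>From the chase to a proof\<close>

lemma atoms_subst_fm: "atom_conj \<phi> \<Longrightarrow> atoms (subst_fm \<sigma> \<phi>) = subst_atom \<sigma> ` atoms \<phi>"
  by (induction \<phi> rule: atom_conj.induct) auto

lemma atom_conj_subst_fm: "atom_conj \<phi> \<Longrightarrow> atom_conj (subst_fm \<sigma> \<phi>)"
  by (induction \<phi> rule: atom_conj.induct) auto

text \<open>The hypotheses exclude capture, so no bound variable is renamed and the substitution
  passes through the quantifier block.\<close>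

lemma subst1_exists_vars:
  assumes "x \<notin> set ys" and "vars_trm t \<inter> set ys = {}"
  shows "subst1 (exists_vars ys \<phi>) t x = exists_vars ys (subst1 \<phi> t x)"
  using assms
proof (induction ys)
  case (Cons y ys)
  have "y \<notin> (\<Union>v\<in>free_vars (exists_vars ys \<phi>) - {y}. vars_trm ((Var(x := t)) v))"
    using Cons.prems by auto
  moreover have "(Var(x := t))(y := Var y) = Var(x := t)"
    using Cons.prems by auto
  ultimately show ?case
    using Cons by (simp add: exists_vars_def subst1_def Let_def del: fun_upd_apply)
qed (simp add: exists_vars_def)

lemma G3_atom_conj:
  "\<lbrakk>atom_conj \<phi>; Atm ` atoms \<phi> \<subseteq> \<Gamma>; finite \<Gamma>; finite \<Delta>\<rbrakk> \<Longrightarrow> G3 R \<Gamma> (insert \<phi> \<Delta>)"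
proof (induction \<phi> rule: atom_conj.induct)
  case (1 a)
  then show ?case
    using G3.Id[of \<Gamma> \<Delta> R a] by (simp add: insert_absorb)
next
  case (2 \<phi> \<psi>)
  then show ?case
    by (auto intro: G3.ConjR)
qed simp_all

text \<open>One \<open>ExR\<close> per quantifier, with witness \<open>\<mu> y\<close>. Since
  \<open>ExR\<close> keeps its principal formula and substitutes into the matrix, the induction
  generalises over \<open>\<Delta>\<close> and \<open>q\<close>; the substitution is the identity
  off \<open>ys\<close> because earlier witnesses are already in place.\<close>

lemma G3_exists_vars:
  assumes "atom_conj q" and "distinct ys"
    and "\<forall>y\<in>set ys. vars_trm (\<mu> y) \<inter> set ys = {}"
    and "Atm ` subst_atom (\<lambda>v. if v \<in> set ys then \<mu> v else Var v) ` atoms q \<subseteq> \<Gamma>"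
    and "finite \<Gamma>" and "finite \<Delta>"
  shows "G3 R \<Gamma> (insert (exists_vars ys q) \<Delta>)"
  using assms
proof (induction ys arbitrary: q \<Delta>)
  case Nil
  then show ?case
    by (simp add: exists_vars_def G3_atom_conj)
next
  case (Cons y ys)
  let ?q = "subst1 q (\<mu> y) y"
  let ?E = "exists_vars (y # ys) q"
  \<comment> \<open>Instantiating \<open>y\<close> first and \<open>ys\<close> later agrees with
    doing it all at once: \<open>\<mu> y\<close> contains no variable of \<open>ys\<close>.\<close>
  have "subst_trm (\<lambda>v. if v \<in> set ys then \<mu> v else Var v) ((Var(y := \<mu> y)) v) =
      (if v \<in> set (y # ys) then \<mu> v else Var v)" for v
  proof (cases "v = y")
    case True
    have "subst_trm (\<lambda>v. if v \<in> set ys then \<mu> v else Var v) (\<mu> y) = subst_trm Var (\<mu> y)"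
      using Cons.prems(3) by (intro subst_trm_cong) auto
    with True show ?thesis
      by simp
  qed auto
  then have "subst_atom (\<lambda>v. if v \<in> set ys then \<mu> v else Var v) ` atoms ?q =
      subst_atom (\<lambda>v. if v \<in> set (y # ys) then \<mu> v else Var v) ` atoms q"
    using Cons.prems(1)
    by (simp add: subst1_def atoms_subst_fm image_image subst_atom_comp del: fun_upd_apply)
  then have "G3 R \<Gamma> (insert (exists_vars ys ?q) (insert ?E \<Delta>))"
    using Cons.prems by (intro Cons.IH) (auto simp: subst1_def atom_conj_subst_fm)
  moreover have "exists_vars ys ?q = subst1 (exists_vars ys q) (\<mu> y) y"
    using Cons.prems by (auto simp: subst1_exists_vars)
  ultimately have "G3 R \<Gamma> (insert (Ex y (exists_vars ys q))
      (insert (subst1 (exists_vars ys q) (\<mu> y) y) \<Delta>))"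
    by (simp add: exists_vars_def insert_commute)
  then show ?case
    by (auto simp: exists_vars_def dest: G3.ExR)
qed

text \<open>Read from the root upwards, the proof applies one \<open>Rule\<close> per chase step,
  hence the induction from the first step. The map \<open>h\<close> from chase instances to
  antecedents grows at each step and is therefore generalised.\<close>

lemma G3_if_steps:
  assumes R: "\<forall>\<rho>\<in>R. existential_rule \<rho>" and q: "bcq xs q"
    and "(step R)\<^sup>*\<^sup>* I J" and \<mu>: "subst_atom \<mu> ` atoms q \<subseteq> J"
    and "finite I" and "vars_inst (subst_atom h ` I) \<inter> set xs = {}"
  shows "G3 R (Atm ` subst_atom h ` I) {exists_vars xs q}"
  using assms(3,5,6)
proof (induction arbitrary: h rule: converse_rtranclp_induct)
  case base
  \<comment> \<open>The chase ends here: the match of the query in \<open>J\<close>, pushed through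
    \<open>h\<close>, supplies the witnesses for \<open>ExR\<close>.\<close>
  let ?\<mu> = "\<lambda>v. subst_trm h (\<mu> v)"
  have sub: "subst_atom ?\<mu> ` atoms q \<subseteq> subst_atom h ` J"
    using \<mu> by (auto simp: subst_atom_comp[symmetric])
  have q': "atom_conj q" "distinct xs" "vars_fm q = set xs"
    using q by (auto simp: bcq_def)
  have "subst_atom (\<lambda>v. if v \<in> set xs then ?\<mu> v else Var v) ` atoms q = subst_atom ?\<mu> ` atoms q"
    using q'(3) vars_atom_subset_vars_fm by (intro image_cong refl subst_atom_cong) auto
  moreover have "vars_trm (?\<mu> x) \<inter> set xs = {}" if "x \<in> set xs" for x
  proof -
    have "?\<mu> x \<in> terms (subst_atom h ` J)"
      using assignment_if_match[OF q'(1) sub] that q'(3) by (auto simp: assignment_def)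
    then show ?thesis
      using vars_in_terms base(2) by blast
  qed
  ultimately show ?case
    using sub base(1) q' by (intro G3_exists_vars[where \<mu> = ?\<mu>]) auto
next
  case (step I I')
  from step(1) obtain \<rho> \<mu>' \<zeta> where \<rho>: "\<rho> \<in> R"
    and as: "assignment I (vars_fm (body \<rho>)) \<mu>'" and bd: "subst_atom \<mu>' ` atoms (body \<rho>) \<subseteq> I"
    and \<zeta>: "inj_on \<zeta> (set (zvars \<rho>))" "\<zeta> ` set (zvars \<rho>) \<inter> vars_inst I = {}"
    and I': "I' = I \<union> subst_atom (with_fresh \<mu>' (zvars \<rho>) \<zeta>) ` atoms (head \<rho>)"
    by (auto simp: step_def is_trigger_def application_def)
  let ?\<Gamma> = "Atm ` subst_atom h ` I"
  let ?\<Delta> = "{exists_vars xs q}"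
  let ?\<sigma> = "\<lambda>v. subst_trm h (\<mu>' v)"
  \<comment> \<open>The new variables avoid the sequent, for the side condition of
    \<open>Rule\<close>, and \<open>xs\<close>, for the invariant on \<open>h'\<close>.\<close>
  let ?W = "vars_seq ?\<Gamma> ?\<Delta> \<union> set xs"
  have "finite ?W"
    using step.prems(1) by (auto simp: vars_seq_def)
  then obtain \<zeta>' where \<zeta>': "inj_on \<zeta>' (set (zvars \<rho>))" "\<zeta>' ` set (zvars \<rho>) \<inter> ?W = {}"
    using ex_fresh_renaming by (metis finite_set)
  have \<rho>': "existential_rule \<rho>"
    using R \<rho> by blast
  obtain h' where h': "\<And>v. v \<in> vars_inst I \<Longrightarrow> h' v = h v"
    and hd: "\<And>a. a \<in> atoms (head \<rho>) \<Longrightarrow>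
      subst_atom h' (subst_atom (with_fresh \<mu>' (zvars \<rho>) \<zeta>) a) =
      subst_atom (with_fresh ?\<sigma> (zvars \<rho>) \<zeta>') a"
    by (rule ex_extend_subst[OF \<rho>' \<zeta>, of \<mu>' h \<zeta>']) (use bd in \<open>auto simp: vars_inst_def\<close>)
  let ?A = "subst_atom (with_fresh ?\<sigma> (zvars \<rho>) \<zeta>') ` atoms (head \<rho>)"
  let ?B = "subst_atom ?\<sigma> ` atoms (body \<rho>)"
  have "subst_atom h' ` I = subst_atom h ` I"
    using h' by (intro image_cong refl subst_atom_cong) (auto simp: vars_inst_def)
  moreover have "subst_atom h' ` subst_atom (with_fresh \<mu>' (zvars \<rho>) \<zeta>) ` atoms (head \<rho>) = ?A"
    using hd by (simp add: image_image)
  ultimately have eq: "subst_atom h' ` I' = subst_atom h ` I \<union> ?A"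
    by (simp add: I' image_Un)
  have B: "?B \<subseteq> subst_atom h ` I"
    using bd by (auto simp: subst_atom_comp[symmetric])
  \<comment> \<open>The invariant survives: existential variables avoid \<open>xs\<close> by the
    choice of \<open>\<zeta>'\<close>, and all other values already occur in the image of the
    matched body.\<close>
  have "vars_inst ?A \<inter> set xs = {}"
  proof -
    have "vars_trm (with_fresh ?\<sigma> (zvars \<rho>) \<zeta>' v) \<inter> set xs = {}"
      if "a \<in> atoms (head \<rho>)" "v \<in> vars_atom a" for a v
    proof (cases "v \<in> set (zvars \<rho>)")
      case True
      then show ?thesis
        using \<zeta>'(2) by (auto simp: with_fresh_def)
    next
      case False
      moreover have "v \<in> set (zvars \<rho>) \<or> v \<in> vars_inst (atoms (body \<rho>))"
        by (rule head_var_cases[OF \<rho>' that])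
      ultimately obtain b where "b \<in> atoms (body \<rho>)" "v \<in> vars_atom b"
        by (auto simp: vars_inst_def)
      then have "?\<sigma> v \<in> terms (subst_atom h ` I)"
        using B subst_var_in_args[of v b ?\<sigma>] unfolding terms_def by blast
      with False show ?thesis
        using vars_in_terms step.prems(2) by (auto simp: with_fresh_def)
    qed
    then show ?thesis
      by (fastforce simp: vars_inst_def vars_subst_atom)
  qed
  then have "vars_inst (subst_atom h' ` I') \<inter> set xs = {}"
    using step.prems(2) unfolding eq by (auto simp: vars_inst_def)
  moreover have "finite I'"
    using step.prems(1) I' by simp
  ultimately have "G3 R (Atm ` subst_atom h' ` I') ?\<Delta>"
    by (intro step.IH)
  \<comment> \<open>The matched body already belongs to the antecedent, so adding it changes nothing
    and the sequent takes the shape of the premise of \<open>Rule\<close>.\<close>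
  then have "G3 R (?\<Gamma> \<union> Atm ` ?B \<union> Atm ` ?A) ?\<Delta>"
    using B unfolding eq by (simp add: image_Un Un_absorb2 image_mono)
  moreover have "?\<Gamma> \<union> Atm ` ?B = ?\<Gamma>"
    using B by blast
  moreover have "\<zeta>' ` set (zvars \<rho>) \<inter> vars_seq ?\<Gamma> ?\<Delta> = {}"
    using \<zeta>'(2) by blast
  ultimately show ?case
    using G3.Rule[OF \<rho> refl refl \<zeta>'(1), of ?\<Gamma> ?\<sigma> ?\<Delta>] by simp
qed

section \<open>From a proof to the chase\<close>

text \<open>Truth in the structure whose domain is all of \<open>trm\<close>, with \<open>I\<close>
  as the set of true atoms and constants denoting themselves. The unrestricted domain accommodates
  the arbitrary term of \<open>ExR\<close>.\<close>

primrec sat :: "inst \<Rightarrow> (nat \<Rightarrow> trm) \<Rightarrow> fm \<Rightarrow> bool" where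
  "sat I e (Atm a) \<longleftrightarrow> subst_atom e a \<in> I"
| "sat I e (Neg \<phi>) \<longleftrightarrow> \<not> sat I e \<phi>"
| "sat I e (Conj \<phi> \<psi>) \<longleftrightarrow> sat I e \<phi> \<and> sat I e \<psi>"
| "sat I e (Ex x \<phi>) \<longleftrightarrow> (\<exists>t. sat I (e(x := t)) \<phi>)"

primrec neg_free :: "fm \<Rightarrow> bool" where
  "neg_free (Atm a) \<longleftrightarrow> True"
| "neg_free (Neg \<phi>) \<longleftrightarrow> False"
| "neg_free (Conj \<phi> \<psi>) \<longleftrightarrow> neg_free \<phi> \<and> neg_free \<psi>"
| "neg_free (Ex x \<phi>) \<longleftrightarrow> neg_free \<phi>"

lemma neg_free_subst_fm: "neg_free \<phi> \<Longrightarrow> neg_free (subst_fm \<sigma> \<phi>)"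
  by (induction \<phi> arbitrary: \<sigma>) (auto simp: Let_def)

lemma sat_mono: "sat I e \<phi> \<Longrightarrow> neg_free \<phi> \<Longrightarrow> I \<subseteq> J \<Longrightarrow> sat J e \<phi>"
  by (induction \<phi> arbitrary: e) auto

lemma sat_cong: "(\<And>v. v \<in> free_vars \<phi> \<Longrightarrow> e v = e' v) \<Longrightarrow> sat I e \<phi> = sat I e' \<phi>"
proof (induction \<phi> arbitrary: e e')
  case (Atm a)
  then have "subst_atom e a = subst_atom e' a"
    by (intro subst_atom_cong) auto
  then show ?case
    by simp
next
  case (Neg \<phi>)
  then have "sat I e \<phi> = sat I e' \<phi>"
    by (intro Neg.IH) auto
  then show ?case
    by simp
next
  case (Conj \<phi> \<psi>)
  have "sat I e \<phi> = sat I e' \<phi>" "sat I e \<psi> = sat I e' \<psi>"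
    using Conj.prems by (intro Conj.IH; simp)+
  then show ?case
    by simp
next
  case (Ex x \<phi>)
  have "sat I (e(x := t)) \<phi> = sat I (e'(x := t)) \<phi>" for t
    using Ex.prems by (intro Ex.IH) auto
  then show ?case
    by simp
qed

text \<open>The substitution lemma. Under a quantifier, the chosen bound variable avoids all
  variables brought in, so updating the environment there leaves their values intact.\<close>

lemma sat_subst_fm: "sat I e (subst_fm \<sigma> \<phi>) = sat I (\<lambda>v. subst_trm e (\<sigma> v)) \<phi>"
proof (induction \<phi> arbitrary: e \<sigma>)
  case (Ex x \<phi>)
  let ?V = "\<Union>v\<in>free_vars \<phi> - {x}. vars_trm (\<sigma> v)"
  \<comment> \<open>The bound variable exactly as \<open>subst_fm\<close> picks it; finiteness of
    \<open>?V\<close> makes the \<open>LEAST\<close> well defined.\<close>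
  define x' where "x' = (if x \<in> ?V then LEAST z. z \<notin> ?V else x)"
  have "finite ?V"
    by auto
  then have "(LEAST z. z \<notin> ?V) \<notin> ?V"
    using ex_new_if_finite[OF infinite_UNIV_nat] by (metis (mono_tags, lifting) LeastI)
  then have x': "x' \<notin> ?V"
    unfolding x'_def by (cases "x \<in> ?V") simp_all
  have "sat I (e(x' := t)) (subst_fm (\<sigma>(x := Var x')) \<phi>) =
      sat I ((\<lambda>v. subst_trm e (\<sigma> v))(x := t)) \<phi>" for t
    unfolding Ex.IH
  proof (rule sat_cong)
    fix v
    assume v: "v \<in> free_vars \<phi>"
    show "subst_trm (e(x' := t)) ((\<sigma>(x := Var x')) v) = ((\<lambda>v. subst_trm e (\<sigma> v))(x := t)) v"
    proof (cases "v = x")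
      case False
      then have "x' \<notin> vars_trm (\<sigma> v)"
        using x' v by blast
      then have "subst_trm (e(x' := t)) (\<sigma> v) = subst_trm e (\<sigma> v)"
        by (intro subst_trm_cong) auto
      with False show ?thesis
        by simp
    qed simp
  qed
  moreover have "subst_fm \<sigma> (Ex x \<phi>) = Ex x' (subst_fm (\<sigma>(x := Var x')) \<phi>)"
    by (simp add: x'_def Let_def)
  ultimately show ?case
    by simp
qed (simp_all add: subst_atom_comp)

lemma sat_subst1: "sat I e (subst1 \<phi> t x) = sat I (e(x := subst_trm e t)) \<phi>"
  unfolding subst1_def sat_subst_fm by (intro sat_cong) simp

lemma sat_atom_conj: "atom_conj \<phi> \<Longrightarrow> sat I e \<phi> \<longleftrightarrow> subst_atom e ` atoms \<phi> \<subseteq> I"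
  by (induction \<phi> rule: atom_conj.induct) auto

lemma sat_exists_varsD: "sat I e (exists_vars xs \<phi>) \<Longrightarrow> \<exists>e'. sat I e' \<phi>"
  by (induction xs arbitrary: e) (auto simp: exists_vars_def)

lemma neg_free_exists_vars: "atom_conj q \<Longrightarrow> neg_free (exists_vars xs q)"
proof (induction xs)
  case Nil
  then show ?case
    unfolding exists_vars_def by (induction q rule: atom_conj.induct) auto
qed (simp add: exists_vars_def)

section \<open>Soundness of the calculus with respect to the chase\<close>

lemma steps_if_G3:
  assumes R: "\<forall>\<rho>\<in>R. existential_rule \<rho>" and "G3 R \<Gamma> \<Delta>"
    and "\<Gamma> \<subseteq> range Atm" and "\<forall>\<delta>\<in>\<Delta>. neg_free \<delta>" and "finite J" and "\<forall>\<gamma>\<in>\<Gamma>. sat J e \<gamma>"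
  shows "\<exists>J'. (step R)\<^sup>*\<^sup>* J J' \<and> (\<exists>\<delta>\<in>\<Delta>. sat J' e \<delta>)"
  using assms(2-)
proof (induction arbitrary: J e rule: G3.induct)
  case (Id \<Gamma> \<Delta> a)
  then show ?case
    by blast
next
  case (NegL \<Gamma> \<phi> \<Delta>)
  \<comment> \<open>Vacuous, as antecedents hold only atoms; likewise \<open>ConjL\<close> and
    \<open>ExL\<close>. \<open>NegR\<close> is excluded by \<open>neg_free\<close>.\<close>
  from NegL.prems(1) show ?case
    by blast
next
  case (NegR \<phi> \<Gamma> \<Delta>)
  from NegR.prems(2) show ?case
    by simp
next
  case (ConjL \<phi> \<psi> \<Gamma> \<Delta>)
  from ConjL.prems(1) show ?case
    by blast
next
  case (ConjR \<Gamma> \<phi> \<Delta> \<psi>)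
  obtain J1 where J1: "(step R)\<^sup>*\<^sup>* J J1" "\<exists>\<delta>\<in>insert \<phi> \<Delta>. sat J1 e \<delta>"
    using ConjR.IH(1)[of J e] ConjR.prems by auto
  have "\<forall>\<gamma>\<in>\<Gamma>. sat J1 e \<gamma>"
    using ConjR.prems(1,4) steps_mono[OF J1(1)] by fastforce
  then obtain J2 where J2: "(step R)\<^sup>*\<^sup>* J1 J2" "\<exists>\<delta>\<in>insert \<psi> \<Delta>. sat J2 e \<delta>"
    using ConjR.IH(2)[of J1 e] ConjR.prems steps_finite[OF J1(1)] by auto
  have "\<exists>\<delta>\<in>insert \<phi> \<Delta>. sat J2 e \<delta>"
    using J1(2) steps_mono[OF J2(1)] ConjR.prems(2) sat_mono by fastforce
  \<comment> \<open>Either some formula of \<open>\<Delta>\<close> holds in \<open>J2\<close>, or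
    both conjuncts do.\<close>
  with J2(2) have "\<exists>\<delta>\<in>insert (Conj \<phi> \<psi>) \<Delta>. sat J2 e \<delta>"
    by auto
  then show ?case
    using J1(1) J2(1) by (meson rtranclp_trans)
next
  case (ExL \<phi> y x \<Gamma> \<Delta>)
  from ExL.prems(1) show ?case
    by blast
next
  case (ExR \<Gamma> x \<phi> t \<Delta>)
  then have "\<forall>\<delta>\<in>insert (Ex x \<phi>) (insert (subst1 \<phi> t x) \<Delta>). neg_free \<delta>"
    by (simp add: subst1_def neg_free_subst_fm)
  then obtain J' where J': "(step R)\<^sup>*\<^sup>* J J'"
      "\<exists>\<delta>\<in>insert (Ex x \<phi>) (insert (subst1 \<phi> t x) \<Delta>). sat J' e \<delta>"
    using ExR.IH ExR.prems by blast
  then show ?case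
    by (auto simp: sat_subst1)
next
  case (Rule \<rho> B \<sigma> A \<zeta> \<Gamma> \<Delta>)
  \<comment> \<open>Evaluating the rule instance \<open>\<sigma>\<close> under \<open>e\<close>
    gives the trigger to be applied in \<open>J\<close>.\<close>
  let ?\<mu> = "\<lambda>v. subst_trm e (\<sigma> v)"
  have \<rho>: "existential_rule \<rho>"
    using R Rule.hyps(1) by blast
  have "\<forall>a\<in>atoms (body \<rho>). sat J e (Atm (subst_atom \<sigma> a))"
    using Rule.prems(4) Rule.hyps(2) by blast
  then have bd: "subst_atom ?\<mu> ` atoms (body \<rho>) \<subseteq> J"
    by (auto simp: subst_atom_comp)
  then have trig: "is_trigger J (\<rho>, ?\<mu>)"
    using \<rho> assignment_if_match[OF _ bd] by (auto simp: is_trigger_def existential_rule_def)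
  obtain \<zeta>' where \<zeta>': "inj_on \<zeta>' (set (zvars \<rho>))" "\<zeta>' ` set (zvars \<rho>) \<inter> vars_inst J = {}"
    using ex_fresh_renaming finite_vars_inst[OF Rule.prems(3)] by (metis finite_set)
  define J1 where "J1 = J \<union> subst_atom (with_fresh ?\<mu> (zvars \<rho>) \<zeta>') ` atoms (head \<rho>)"
  have st: "step R J J1"
    using trig \<zeta>' Rule.hyps(1) unfolding step_def application_def J1_def
    by (intro exI[of _ "(\<rho>, ?\<mu>)"]) auto
  \<comment> \<open>The fresh variables of the proof are reinterpreted as those of the chase step,
    which makes \<open>A\<close> true in \<open>J1\<close>; the conclusion does not mention them, so
    its formulae keep their truth values.\<close>
  obtain e' where e': "\<And>v. v \<in> vars_seq (\<Gamma> \<union> B) \<Delta> \<Longrightarrow> e' v = e v"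
    and hd: "\<And>a. a \<in> atoms (head \<rho>) \<Longrightarrow>
      subst_atom e' (subst_atom (with_fresh \<sigma> (zvars \<rho>) \<zeta>) a) =
      subst_atom (with_fresh ?\<mu> (zvars \<rho>) \<zeta>') a"
    by (rule ex_extend_subst[OF \<rho> Rule.hyps(4,5), of \<sigma> e \<zeta>'])
      (auto simp: vars_inst_def vars_seq_def Rule.hyps(2))
  have sat_e': "sat K e' \<phi> = sat K e \<phi>" if "\<phi> \<in> \<Gamma> \<union> B \<union> \<Delta>" for K \<phi>
    using that free_vars_subset_vars_fm[of \<phi>] by (intro sat_cong e') (auto simp: vars_seq_def)
  have "sat J1 e' \<gamma>" if "\<gamma> \<in> \<Gamma> \<union> B" for \<gamma>
  proof -
    have "sat J e' \<gamma>"
      using that Rule.prems(4) sat_e' by blast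
    moreover have "neg_free \<gamma>"
      using that Rule.prems(1) by auto
    ultimately show ?thesis
      using sat_mono by (auto simp: J1_def)
  qed
  moreover have "sat J1 e' \<gamma>" if "\<gamma> \<in> A" for \<gamma>
    using that hd by (auto simp: Rule.hyps(3) J1_def)
  moreover have "\<Gamma> \<union> B \<union> A \<subseteq> range Atm"
    using Rule.prems(1) Rule.hyps(3) by auto
  ultimately obtain J' where "(step R)\<^sup>*\<^sup>* J1 J'" "\<exists>\<delta>\<in>\<Delta>. sat J' e' \<delta>"
    using Rule.IH[of J1 e'] Rule.prems(2,3) step_finite[OF st] by blast
  then show ?case
    using sat_e' st by (metis Un_iff converse_rtranclp_into_rtranclp)
qed

theorem theorem9:
  fixes R :: "erule set" and D :: inst and xs :: "nat list" and q :: fm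
  assumes "rule_set R" and "database D" and "bcq xs q"
  shows "(\<exists>n I \<tau>. chase_derivation n I \<tau> \<and> witnesses n I \<tau> D R q) \<longleftrightarrow>
         G3 R (Atm ` D) {exists_vars xs q}"
proof -
  have R: "\<forall>\<rho>\<in>R. existential_rule \<rho>"
    using assms(1) by (simp add: rule_set_def)
  have fin: "finite D"
    using assms(2) by (simp add: database_def)
  have q: "atom_conj q"
    using assms(3) by (simp add: bcq_def)
  show ?thesis
    unfolding ex_witness_iff
  proof
    assume "\<exists>J \<mu>. (step R)\<^sup>*\<^sup>* D J \<and> assignment J (vars_fm q) \<mu> \<and> subst_atom \<mu> ` atoms q \<subseteq> J"
    then obtain J \<mu> where J: "(step R)\<^sup>*\<^sup>* D J" "subst_atom \<mu> ` atoms q \<subseteq> J"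
      by blast
    have "vars_inst D = {}"
      using assms(2) by (fastforce simp: database_def ground_def vars_inst_def vars_atom_def)
    then show "G3 R (Atm ` D) {exists_vars xs q}"
      \<comment> \<open>A ground database has no variables, so the identity is an admissible initial
        map.\<close>
      using G3_if_steps[OF R assms(3) J fin, of Var] by simp
  next
    assume "G3 R (Atm ` D) {exists_vars xs q}"
    then obtain J where J: "(step R)\<^sup>*\<^sup>* D J" "sat J Var (exists_vars xs q)"
      using steps_if_G3[OF R, of "Atm ` D" "{exists_vars xs q}" D Var] fin q
      by (auto simp: neg_free_exists_vars)
    from J(2) obtain \<mu> where "sat J \<mu> q"
      using sat_exists_varsD by blast
    then have \<mu>: "subst_atom \<mu> ` atoms q \<subseteq> J"
      by (simp add: sat_atom_conj q)
    show "\<exists>J \<mu>. (step R)\<^sup>*\<^sup>* D J \<and> assignment J (vars_fm q) \<mu> \<and> subst_atom \<mu> ` atoms q \<subseteq> J"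
      using J(1) \<mu> assignment_if_match[OF q \<mu>] by blast
  qed
qed

end
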